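(* Let $H$ be a contextuality scenario. A probabilistic model $p\in\mathcal{G}(H)$ is classical, $p\in\mathcal{C}(H)$, if and only if $\alpha^*(\mathrm{NO}(H),p)=1$.
   Context: A contextuality scenario is a hypergraph $H$ with finite nonempty vertex set $V(H)$ and edge set $E(H)\subseteq 2^{V(H)}$ such that $\bigcup_{e\in E(H)}e=V(H)$. A probabilistic model on $H$ is a map $p:V(H)\to[0,1]$ with $\sum_{v\in e}p(v)=1$ for all $e\in E(H)$; $\mathcal{G}(H)$ is the set of these. A probabilistic model is deterministic if all its values lie in $\{0,1\}$, and classical if it is a convex combination of deterministic probabilistic models; $\mathcal{C}(H)$ is the set of classical models. The non-orthogonality graph $\mathrm{NO}(H)$ is the simple graph on $V(H)$ in which $u$ and $v$ are adjacent iff no edge $e\in E(H)$ satisfies $\{u,v\}\subseteq e$. For a graph $G$ with weights $p:V(G)\to\mathbb{R}_{\geq 0}$, the weighted fractional packing number is $\alpha^*(G,p)=\max_q\sum_{v\in V(G)}p(v)q(v)$, where $q:V(G)\to\mathbb{R}_{\geq 0}$ ranges over all functions with $\sum_{v\in C}q(v)\leq 1$ for every clique $C\subseteq V(G)$ (a set of pairwise adjacent vertices; single vertices count as cliques). *)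

theory Defs
  imports "HOL-Analysis.Analysis" "HOL-Library.Ramsey"
begin

section \<open>Contextuality scenarios\<close>

text \<open>
  A hypergraph is given by its vertex set \<open>V\<close> and its edge set \<open>E\<close>. Maps on \<open>V\<close> are extensional
  functions, so that the sets of models below are sets of maps on \<open>V\<close> and equality of models is
  equality on \<open>V\<close>.
\<close>

definition contextuality_scenario :: "'a set \<Rightarrow> 'a set set \<Rightarrow> bool" where
  "contextuality_scenario V E \<longleftrightarrow> finite V \<and> V \<noteq> {} \<and> E \<subseteq> Pow V \<and> \<Union>E = V"

definition probabilistic_models :: "'a set \<Rightarrow> 'a set set \<Rightarrow> ('a \<Rightarrow> real) set" where
  "probabilistic_models V E = {p \<in> V \<rightarrow>\<^sub>E {0..1}. \<forall>e\<in>E. (\<Sum>v\<in>e. p v) = 1}"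

definition deterministic_models :: "'a set \<Rightarrow> 'a set set \<Rightarrow> ('a \<Rightarrow> real) set" where
  "deterministic_models V E = {p \<in> probabilistic_models V E. \<forall>v\<in>V. p v \<in> {0, 1}}"

definition classical_models :: "'a set \<Rightarrow> 'a set set \<Rightarrow> ('a \<Rightarrow> real) set" where
  "classical_models V E =
     {p \<in> probabilistic_models V E.
        \<exists>(n::nat) (w :: nat \<Rightarrow> real) (d :: nat \<Rightarrow> 'a \<Rightarrow> real).
          (\<forall>i<n. 0 \<le> w i) \<and> (\<Sum>i<n. w i) = 1 \<and> (\<forall>i<n. d i \<in> deterministic_models V E) \<and>
          (\<forall>v\<in>V. p v = (\<Sum>i<n. w i * d i v))}"

section \<open>Weighted fractional packing number\<close>

text \<open>
  A simple graph is given by its vertex set \<open>V\<close> and a set \<open>F\<close> of two-element subsets of \<open>V\<close>,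
  as for \<^const>\<open>clique\<close>.
\<close>

definition non_orthogonality_edges :: "'a set \<Rightarrow> 'a set set \<Rightarrow> 'a set set" where
  "non_orthogonality_edges V E =
     {{u, v} |u v. u \<in> V \<and> v \<in> V \<and> u \<noteq> v \<and> \<not> (\<exists>e\<in>E. {u, v} \<subseteq> e)}"

definition fractional_packings :: "'a set \<Rightarrow> 'a set set \<Rightarrow> ('a \<Rightarrow> real) set" where
  "fractional_packings V F =
     {q \<in> V \<rightarrow>\<^sub>E {0..}. \<forall>C. C \<subseteq> V \<and> clique C F \<longrightarrow> (\<Sum>v\<in>C. q v) \<le> 1}"

text \<open>
  \<open>GREATEST\<close> is the maximum if there is one; for finite \<open>V\<close> there is, by
  \<open>fractional_packing_number_attained\<close>.
\<close>

definition fractional_packing_number :: "'a set \<Rightarrow> 'a set set \<Rightarrow> ('a \<Rightarrow> real) \<Rightarrow> real" where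
  "fractional_packing_number V F p =
     (GREATEST x. \<exists>q\<in>fractional_packings V F. x = (\<Sum>v\<in>V. p v * q v))"

lemma compact_fractional_packings:
  assumes "finite V"
  shows "compact (fractional_packings V F)"
proof -
  define B :: "('a \<Rightarrow> real) set"
    where "B = (\<Pi>\<^sub>E v\<in>UNIV. if v \<in> V then {0..1} else {undefined})"
  have "compactin (product_topology (\<lambda>_. euclidean) UNIV) B"
    unfolding B_def compactin_PiE by auto
  then have "compact B"
    by (simp add: euclidean_product_topology)
  moreover have "closed (\<Inter>C\<in>{C. C \<subseteq> V \<and> clique C F}. {q :: 'a \<Rightarrow> real. (\<Sum>v\<in>C. q v) \<le> 1})"
    by (intro closed_INT ballI closed_Collect_le continuous_on_sum
        continuous_on_product_coordinates continuous_on_const)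
  moreover have "fractional_packings V F =
      B \<inter> (\<Inter>C\<in>{C. C \<subseteq> V \<and> clique C F}. {q. (\<Sum>v\<in>C. q v) \<le> 1})"
  proof (intro set_eqI iffI)
    fix q assume q: "q \<in> fractional_packings V F"
    have "q v \<le> 1" if "v \<in> V" for v
    proof -
      have "{v} \<subseteq> V \<and> clique {v} F"
        using that by (simp add: clique_def)
      then have "(\<Sum>u\<in>{v}. q u) \<le> 1"
        using q unfolding fractional_packings_def by blast
      then show ?thesis by simp
    qed
    then show "q \<in> B \<inter> (\<Inter>C\<in>{C. C \<subseteq> V \<and> clique C F}. {q. (\<Sum>v\<in>C. q v) \<le> 1})"
      using q by (auto simp: fractional_packings_def B_def PiE_iff extensional_def)
  next
    fix q assume "q \<in> B \<inter> (\<Inter>C\<in>{C. C \<subseteq> V \<and> clique C F}. {q. (\<Sum>v\<in>C. q v) \<le> 1})"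
    then show "q \<in> fractional_packings V F"
      by (auto simp: fractional_packings_def B_def PiE_iff extensional_def split: if_splits)
  qed
  ultimately show ?thesis
    by (simp add: compact_Int_closed)
qed

lemma fractional_packing_number_attained:
  assumes "finite V"
  shows "\<exists>q\<in>fractional_packings V F.
           fractional_packing_number V F p = (\<Sum>v\<in>V. p v * q v) \<and>
           (\<forall>r\<in>fractional_packings V F. (\<Sum>v\<in>V. p v * r v) \<le> (\<Sum>v\<in>V. p v * q v))"
proof -
  have "(\<lambda>v\<in>V. 0) \<in> fractional_packings V F"
    by (auto simp: fractional_packings_def restrict_def subset_iff)
  moreover have "continuous_on (fractional_packings V F) (\<lambda>q. \<Sum>v\<in>V. p v * q v)"
    by (rule continuous_on_subset[OF _ subset_UNIV])
       (intro continuous_on_sum continuous_on_mult continuous_on_const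
          continuous_on_product_coordinates)
  ultimately obtain q where q: "q \<in> fractional_packings V F"
      "\<forall>r\<in>fractional_packings V F. (\<Sum>v\<in>V. p v * r v) \<le> (\<Sum>v\<in>V. p v * q v)"
    using continuous_attains_sup[OF compact_fractional_packings[OF assms]] by blast
  moreover have "fractional_packing_number V F p = (\<Sum>v\<in>V. p v * q v)"
    unfolding fractional_packing_number_def
    by (rule Greatest_equality) (use q in auto)
  ultimately show ?thesis by blast
qed

end

theory Submission
  imports Defs
begin

text \<open>
  The clique polytope of \<open>NO(H)\<close>, the convex hull of the indicator functions of cliques, is closed
  under passing to smaller nonnegative vectors. If \<open>p\<close> lies outside it, a separating functional
  can therefore be replaced by its positive part and rescaled to a fractional packing of weight
  greater than 1. So \<open>\<alpha>* = 1\<close> forces \<open>p\<close> to be a convex combination of cliques; since a clique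
  meets every edge in at most one vertex and \<open>p\<close> sums to 1 on every edge, each clique of positive
  weight meets every edge exactly once, i.e. is a deterministic model. Conversely the support
  of a deterministic model is a clique, and indicators of edges are packings of weight 1.
\<close>

section \<open>Separation from the convex hull of finitely many points\<close>

lemma compact_simplex_functions:
  fixes I :: "'i set"
  assumes "finite I"
  shows "compact {x \<in> I \<rightarrow>\<^sub>E {0::real..}. sum x I = 1}"
proof -
  \<comment> \<open>Off \<open>I\<close> every factor is the singleton \<open>{undefined}\<close>,
    so the product over the whole type has compact factors and Tychonoff applies even if the type is
    infinite.\<close>
  define B :: "('i \<Rightarrow> real) set"
    where "B = (\<Pi>\<^sub>E i\<in>UNIV. if i \<in> I then {0..1} else {undefined})"
  have "compactin (product_topology (\<lambda>_. euclidean) UNIV) B"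
    unfolding B_def compactin_PiE by auto
  then have "compact B"
    by (simp add: euclidean_product_topology)
  moreover have "closed {x :: 'i \<Rightarrow> real. sum x I = 1}"
    by (intro closed_Collect_eq continuous_on_sum continuous_on_product_coordinates
        continuous_on_const)
  moreover have "{x \<in> I \<rightarrow>\<^sub>E {0::real..}. sum x I = 1} = B \<inter> {x. sum x I = 1}"
  proof (intro set_eqI iffI)
    fix x assume x: "x \<in> {x \<in> I \<rightarrow>\<^sub>E {0::real..}. sum x I = 1}"
    then have "x i \<le> 1" if "i \<in> I" for i
      using member_le_sum[of i I x] that assms by (auto simp: PiE_iff)
    then show "x \<in> B \<inter> {x. sum x I = 1}"
      using x by (auto simp: B_def PiE_iff extensional_def)
  next
    fix x assume "x \<in> B \<inter> {x. sum x I = 1}"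
    then show "x \<in> {x \<in> I \<rightarrow>\<^sub>E {0::real..}. sum x I = 1}"
      by (auto simp: B_def PiE_iff extensional_def split: if_splits)
  qed
  ultimately show ?thesis
    by (simp add: compact_Int_closed)
qed

text \<open>
  The separating functional is the residual of the point of the convex hull closest to \<open>p\<close>.
\<close>

lemma convex_combination_or_separated:
  fixes f :: "'i \<Rightarrow> 'a \<Rightarrow> real" and p :: "'a \<Rightarrow> real"
  assumes I: "finite I" "I \<noteq> {}" and V: "finite V"
  obtains (combination) x where "\<And>i. i \<in> I \<Longrightarrow> 0 \<le> x i" "sum x I = 1"
      "\<And>v. v \<in> V \<Longrightarrow> p v = (\<Sum>i\<in>I. x i * f i v)"
    | (separated) a b where "\<And>i. i \<in> I \<Longrightarrow> (\<Sum>v\<in>V. a v * f i v) \<le> b" "b < (\<Sum>v\<in>V. a v * p v)"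
proof -
  define S where "S = {x \<in> I \<rightarrow>\<^sub>E {0::real..}. sum x I = 1}"
  define y where "y x v = (\<Sum>i\<in>I. x i * f i v)" for x v
  define F where "F x = (\<Sum>v\<in>V. (p v - y x v)\<^sup>2)" for x
  obtain i0 where i0: "i0 \<in> I" using I by blast
  have "(\<lambda>i\<in>I. if i = i0 then 1 else 0) \<in> S"
    using i0 I by (auto simp: S_def)
  moreover have "compact S"
    unfolding S_def by (rule compact_simplex_functions[OF I(1)])
  moreover have "continuous_on S F"
    unfolding F_def y_def
    by (rule continuous_on_subset[OF _ subset_UNIV])
      (intro continuous_on_sum continuous_on_mult continuous_on_const continuous_on_power
        continuous_on_diff continuous_on_product_coordinates)
  ultimately obtain x where x: "x \<in> S" and min: "\<And>z. z \<in> S \<Longrightarrow> F x \<le> F z"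
    using continuous_attains_inf[of S F] by blast
  define r where "r v = p v - y x v" for v
  have x0: "0 \<le> x i" if "i \<in> I" for i using x that by (auto simp: S_def)
  have x1: "sum x I = 1" using x by (auto simp: S_def)
  show thesis
  proof (cases "(\<Sum>v\<in>V. (r v)\<^sup>2) = 0")
    case True
    then have "\<forall>v\<in>V. r v = 0"
      using V by (subst (asm) sum_nonneg_eq_0_iff) auto
    with x0 x1 combination[of x] show ?thesis by (auto simp: r_def y_def)
  next
    case False
    then have pos: "0 < (\<Sum>v\<in>V. (r v)\<^sup>2)"
      by (simp add: order_less_le sum_nonneg)
    have "(\<Sum>v\<in>V. r v * f i v) \<le> (\<Sum>v\<in>V. r v * y x v)" if i: "i \<in> I" for i
    proof (rule ccontr)
      \<comment> \<open>Variational inequality at the minimiser: moving from \<open>x\<close>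
        towards the vertex \<open>i\<close> of the simplex displaces \<open>y x\<close> along
        \<open>g\<close> and changes \<open>F\<close> by \<open>t\<^sup>2 * Q - 2 * t * G\<close>,
        which is negative for small \<open>t\<close> if \<open>G\<close> is positive.\<close>
      define g where "g v = f i v - y x v" for v
      define G where "G = (\<Sum>v\<in>V. r v * g v)"
      define Q where "Q = (\<Sum>v\<in>V. (g v)\<^sup>2)"
      assume "\<not> (\<Sum>v\<in>V. r v * f i v) \<le> (\<Sum>v\<in>V. r v * y x v)"
      then have G: "0 < G"
        by (simp add: G_def g_def right_diff_distrib sum_subtractf)
      have Q: "0 \<le> Q" by (simp add: Q_def sum_nonneg)
      have le: "2 * G \<le> t * Q" if t: "0 < t" "t \<le> 1" for t
      proof -
        define z where "z = (\<lambda>j\<in>I. (1 - t) * x j + t * (if j = i then 1 else 0))"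
        have "sum z I = (1 - t) * sum x I + t * (\<Sum>j\<in>I. if j = i then 1 else 0)"
          by (simp add: z_def sum.distrib sum_distrib_left cong: sum.cong)
        then have "z \<in> S"
          using t x0 x1 i I by (auto simp: S_def z_def)
        have "y z v = y x v + t * g v" for v
        proof -
          have "y z v = (\<Sum>j\<in>I. (1 - t) * (x j * f j v) + (if j = i then t * f j v else 0))"
            unfolding y_def z_def by (rule sum.cong) (auto simp: algebra_simps)
          also have "\<dots> = (1 - t) * y x v + t * f i v"
            using i I by (simp add: sum.distrib y_def sum_distrib_left)
          finally show ?thesis by (simp add: g_def algebra_simps)
        qed
        then have "F z = (\<Sum>v\<in>V. (r v)\<^sup>2 - 2 * t * (r v * g v) + t\<^sup>2 * (g v)\<^sup>2)"
          unfolding F_def by (intro sum.cong) (auto simp: r_def power2_eq_square algebra_simps)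
        also have "\<dots> = F x - 2 * t * G + t\<^sup>2 * Q"
          by (simp add: sum.distrib sum_subtractf sum_distrib_left F_def r_def G_def Q_def)
        finally have "t * (2 * G) \<le> t * (t * Q)"
          using min[OF \<open>z \<in> S\<close>] by (simp add: power2_eq_square mult.assoc mult.left_commute)
        then show ?thesis using t by simp
      qed
      \<comment> \<open>The bound 1 keeps the moved point in the simplex. The denominator
        \<open>Q + 1\<close> covers the case \<open>Q = 0\<close> and gives
        \<open>t * Q \<le> G\<close>, against \<open>2 * G \<le> t * Q\<close>.\<close>
      define t where "t = min 1 (G / (Q + 1))"
      have t: "0 < t" "t \<le> 1" using G Q by (auto simp: t_def)
      have "t * Q \<le> G / (Q + 1) * Q"
        using Q by (intro mult_right_mono) (auto simp: t_def)
      also have "\<dots> \<le> G" using G Q by (simp add: field_simps)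
      finally show False using le[OF t] G by simp
    qed
    moreover have "(\<Sum>v\<in>V. r v * y x v) < (\<Sum>v\<in>V. r v * p v)"
    proof -
      have "(\<Sum>v\<in>V. r v * p v) - (\<Sum>v\<in>V. r v * y x v) = (\<Sum>v\<in>V. (r v)\<^sup>2)"
        unfolding sum_subtractf[symmetric]
        by (intro sum.cong) (auto simp: r_def power2_eq_square algebra_simps)
      with pos show ?thesis by simp
    qed
    ultimately show ?thesis by (rule separated)
  qed
qed

section \<open>The clique polytope of a graph\<close>

lemma sum_indicator_real: "finite A \<Longrightarrow> sum (indicat_real B) A = card (A \<inter> B)"
  using sum_mult_indicator[of A "\<lambda>_. 1::real" "\<lambda>_. B" "\<lambda>v. v"] by (simp add: Int_def)

text \<open>Antiblocking duality between cliques and fractional packings. Subsets of cliques are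
  cliques, so negative coefficients of a separating functional can be discarded without exceeding
  its bound on cliques.\<close>

lemma convex_combination_of_cliques:
  fixes p :: "'a \<Rightarrow> real"
  assumes V: "finite V" and p: "\<And>v. v \<in> V \<Longrightarrow> 0 \<le> p v"
    and packing: "\<And>q. q \<in> fractional_packings V F \<Longrightarrow> (\<Sum>v\<in>V. p v * q v) \<le> 1"
  obtains x where "\<And>C. \<lbrakk>C \<subseteq> V; clique C F\<rbrakk> \<Longrightarrow> 0 \<le> x C" "sum x {C. C \<subseteq> V \<and> clique C F} = 1"
    "\<And>v. v \<in> V \<Longrightarrow> p v = (\<Sum>C | C \<subseteq> V \<and> clique C F. x C * indicator C v)"
proof -
  let ?K = "{C. C \<subseteq> V \<and> clique C F}"
  have fin: "finite ?K" using V by simp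
  have nonempty: "?K \<noteq> {}" by (auto simp: clique_def)
  have sum_ind: "(\<Sum>v\<in>V. a v * indicator C v) = sum a C" if "C \<subseteq> V" for a :: "'a \<Rightarrow> real" and C
    using that V sum_mult_indicator[of V a "\<lambda>_. C" "\<lambda>v. v"]
    by (simp add: Int_absorb1 flip: Int_def)
  show thesis
  proof (cases rule: convex_combination_or_separated[OF fin nonempty V, where p = p and f = indicator,
        case_names combination separated])
    case (combination x)
    show ?thesis by (rule that[of x]) (use combination in auto)
  next
    case (separated a b)
    define q where "q v = max 0 (a v)" for v
    have b: "sum a C \<le> b" if "C \<subseteq> V" "clique C F" for C
      using separated(1)[of C] sum_ind[of C a] that by simp
    have qC: "sum q C \<le> b" if C: "C \<subseteq> V" "clique C F" for C
    proof -
      have "finite C" using C V finite_subset by blast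
      \<comment> \<open>The positive part of \<open>a\<close> sums over \<open>C\<close> to what
        \<open>a\<close> itself sums to over a subclique of \<open>C\<close>.\<close>
      then have "sum q C = sum a {v \<in> C. 0 < a v}"
        by (auto simp: q_def sum.inter_filter max_def intro: sum.cong)
      also have "\<dots> \<le> b" using C by (intro b) (auto simp: clique_def)
      finally show ?thesis .
    qed
    have q0: "0 \<le> q v" for v by (simp add: q_def)
    \<comment> \<open>Since \<open>p\<close> is nonnegative, passing to the positive part does not
      lower the value at \<open>p\<close>.\<close>
    have "(\<Sum>v\<in>V. a v * p v) \<le> (\<Sum>v\<in>V. p v * q v)"
      using p by (intro sum_mono) (auto simp: q_def mult.commute[of "a _"] intro: mult_left_mono)
    with separated(2) have less: "b < (\<Sum>v\<in>V. p v * q v)" by simp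
    \<comment> \<open>Rescaling by \<open>b\<close> needs \<open>b\<close> positive: the empty
      clique gives \<open>0 \<le> b\<close>, and for \<open>b = 0\<close> the singleton cliques
      would make \<open>q\<close> vanish on \<open>V\<close>.\<close>
    have "0 \<le> b" using qC[of "{}"] by (simp add: clique_def)
    moreover have "b \<noteq> 0"
    proof
      assume "b = 0"
      then have "q v = 0" if "v \<in> V" for v
        using qC[of "{v}"] that q0[of v] by (simp add: clique_def)
      with less \<open>b = 0\<close> show False by simp
    qed
    ultimately have b0: "0 < b" by simp
    have "(\<lambda>v\<in>V. q v / b) \<in> fractional_packings V F"
    proof -
      have "(\<Sum>v\<in>C. (\<lambda>v\<in>V. q v / b) v) \<le> 1" if C: "C \<subseteq> V" "clique C F" for C
      proof -
        have "(\<Sum>v\<in>C. (\<lambda>v\<in>V. q v / b) v) = sum q C / b"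
          using C by (subst sum_divide_distrib) (auto intro!: sum.cong)
        then show ?thesis using qC[OF C] b0 by simp
      qed
      then show ?thesis using q0 b0 by (auto simp: fractional_packings_def)
    qed
    from packing[OF this] have "(\<Sum>v\<in>V. p v * q v) / b \<le> 1"
      by (simp add: sum_divide_distrib cong: sum.cong)
    with less b0 show ?thesis by (simp add: field_simps)
  qed
qed

section \<open>Edges, cliques and deterministic models of a scenario\<close>

lemma clique_Int_edge:
  assumes "clique C (non_orthogonality_edges V E)" "e \<in> E" "u \<in> C \<inter> e" "v \<in> C \<inter> e"
  shows "u = v"
proof (rule ccontr)
  assume "u \<noteq> v"
  then have "{u, v} \<in> non_orthogonality_edges V E"
    using assms by (auto simp: clique_def)
  then obtain u' v' where "{u, v} = {u', v'}" "\<not> (\<exists>e\<in>E. {u', v'} \<subseteq> e)"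
    unfolding non_orthogonality_edges_def by blast
  then show False using assms by auto
qed

lemma card_clique_Int_edge_le:
  assumes "clique C (non_orthogonality_edges V E)" "e \<in> E"
  shows "card (C \<inter> e) \<le> 1"
\<comment> \<open>\<open>C\<close> and \<open>e\<close> are not assumed finite; an infinite
  intersection has \<open>card\<close> 0, which satisfies the bound.\<close>
proof (cases "finite (C \<inter> e)")
  case True
  then show ?thesis
    unfolding One_nat_def card_le_Suc0_iff_eq[OF True] using clique_Int_edge[OF assms] by blast
qed simp

text \<open>Two vertices of value 1 in a common edge would push the sum over that edge to at least
  2.\<close>

lemma clique_deterministic_support:
  assumes "contextuality_scenario V E" "d \<in> deterministic_models V E"
  shows "clique {v \<in> V. d v = 1} (non_orthogonality_edges V E)"
  unfolding clique_def
proof (intro ballI impI)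
  fix u v assume uv: "u \<in> {v \<in> V. d v = 1}" "v \<in> {v \<in> V. d v = 1}" "u \<noteq> v"
  have "\<not> {u, v} \<subseteq> e" if e: "e \<in> E" for e
  proof
    assume sub: "{u, v} \<subseteq> e"
    have eV: "e \<subseteq> V" "finite e"
      using assms(1) e finite_subset by (auto simp: contextuality_scenario_def)
    have "sum d {u, v} \<le> sum d e"
      using assms(2) eV sub
      by (intro sum_mono2) (auto simp: deterministic_models_def probabilistic_models_def PiE_iff)
    moreover have "sum d e = 1"
      using assms(2) e by (auto simp: deterministic_models_def probabilistic_models_def)
    ultimately show False using uv by simp
  qed
  then show "{u, v} \<in> non_orthogonality_edges V E"
    using uv unfolding non_orthogonality_edges_def by blast
qed

text \<open>A clique meets an edge in at most one vertex. These packings show that the packing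
  number of a probabilistic model is at least 1.\<close>

lemma indicator_edge_packing:
  assumes "contextuality_scenario V E" "e \<in> E"
  shows "(\<lambda>v\<in>V. indicator e v) \<in> fractional_packings V (non_orthogonality_edges V E)"
proof -
  have "(\<Sum>v\<in>C. (\<lambda>v\<in>V. indicator e v) v) \<le> (1::real)"
    if C: "C \<subseteq> V" "clique C (non_orthogonality_edges V E)" for C
  proof -
    have "finite C"
      using C assms(1) finite_subset by (auto simp: contextuality_scenario_def)
    moreover have "(\<Sum>v\<in>C. (\<lambda>v\<in>V. indicator e v) v) = (\<Sum>v\<in>C. indicator e v :: real)"
      using C by (auto intro!: sum.cong)
    ultimately show ?thesis
      using card_clique_Int_edge_le[OF C(2) assms(2)] by (simp add: sum_indicator_real)
  qed
  then show ?thesis by (auto simp: fractional_packings_def)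
qed

lemma packing_weight_edge:
  assumes "contextuality_scenario V E" "p \<in> probabilistic_models V E" "e \<in> E"
  shows "(\<Sum>v\<in>V. p v * (\<lambda>v\<in>V. indicator e v) v) = 1"
proof -
  have V: "finite V" "e \<subseteq> V" using assms by (auto simp: contextuality_scenario_def)
  have "(\<Sum>v\<in>V. p v * (\<lambda>v\<in>V. indicator e v) v) = (\<Sum>v\<in>V. if v \<in> e then p v else 0)"
    by (rule sum.cong) (auto simp: indicator_def)
  also have "\<dots> = sum p e" using V by (simp add: Int_absorb1 flip: sum.inter_restrict)
  finally show ?thesis using assms by (simp add: probabilistic_models_def)
qed

section \<open>Classicality and the packing bound\<close>

text \<open>The weight of \<open>q\<close> is linear in the model, and at a deterministic model it
  is the sum of \<open>q\<close> over the supporting clique.\<close>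

lemma classical_packing_le_1:
  assumes scen: "contextuality_scenario V E" and p: "p \<in> classical_models V E"
    and q: "q \<in> fractional_packings V (non_orthogonality_edges V E)"
  shows "(\<Sum>v\<in>V. p v * q v) \<le> 1"
proof -
  have V: "finite V" using scen by (simp add: contextuality_scenario_def)
  obtain n w d where w: "\<forall>i<n. 0 \<le> w i" "(\<Sum>i<n::nat. w i) = (1::real)"
    and d: "\<forall>i<n. d i \<in> deterministic_models V E"
    and eq: "\<forall>v\<in>V. p v = (\<Sum>i<n. w i * d i v)"
    using p unfolding classical_models_def by blast
  have le: "(\<Sum>v\<in>V. d i v * q v) \<le> 1" if i: "i < n" for i
  proof -
    have "(\<Sum>v\<in>V. d i v * q v) = (\<Sum>v\<in>V. if d i v = 1 then q v else 0)"
      using d i by (intro sum.cong) (auto simp: deterministic_models_def)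
    also have "\<dots> = sum q {v \<in> V. d i v = 1}" using V by (simp add: sum.inter_filter)
    also have "\<dots> \<le> 1"
      using q clique_deterministic_support[OF scen] d i by (auto simp: fractional_packings_def)
    finally show ?thesis .
  qed
  have "(\<Sum>v\<in>V. p v * q v) = (\<Sum>v\<in>V. \<Sum>i<n. w i * (d i v * q v))"
    using eq by (intro sum.cong) (auto simp: sum_distrib_right mult.assoc)
  also have "\<dots> = (\<Sum>i<n. w i * (\<Sum>v\<in>V. d i v * q v))"
    by (subst sum.swap) (simp add: sum_distrib_left)
  also have "\<dots> \<le> (\<Sum>i<n. w i)"
    using w le by (intro sum_mono) (auto intro: mult_left_le)
  finally show ?thesis using w by simp
qed

lemma classical_if_packing_le_1:
  assumes scen: "contextuality_scenario V E" and p: "p \<in> probabilistic_models V E"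
    and packing: "\<And>q. q \<in> fractional_packings V (non_orthogonality_edges V E) \<Longrightarrow>
      (\<Sum>v\<in>V. p v * q v) \<le> 1"
  shows "p \<in> classical_models V E"
proof -
  let ?F = "non_orthogonality_edges V E"
  let ?K = "{C. C \<subseteq> V \<and> clique C ?F}"
  have V: "finite V" using scen by (simp add: contextuality_scenario_def)
  have fin: "finite ?K" using V by simp
  have p0: "0 \<le> p v" if "v \<in> V" for v
    using p that by (auto simp: probabilistic_models_def PiE_iff)
  obtain x where nonneg: "\<And>C. \<lbrakk>C \<subseteq> V; clique C ?F\<rbrakk> \<Longrightarrow> 0 \<le> x C" and total: "sum x ?K = 1"
    and combination: "\<And>v. v \<in> V \<Longrightarrow> p v = (\<Sum>C\<in>?K. x C * indicator C v)"
    by (rule convex_combination_of_cliques[OF V]) (rule p0 packing that; assumption)+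
  \<comment> \<open>Double counting over \<open>e\<close>: the average of
    \<open>card (C \<inter> e)\<close> with weights \<open>x C\<close> is
    \<open>sum p e = 1\<close>. No term exceeds 1, so every term of nonzero weight equals 1.\<close>
  have card1: "card (C \<inter> e) = 1" if C: "C \<in> ?K" "x C \<noteq> 0" and e: "e \<in> E" for C e
  proof -
    have eV: "e \<subseteq> V" "finite e"
      using scen e finite_subset by (auto simp: contextuality_scenario_def)
    have "1 = sum p e" using p e by (simp add: probabilistic_models_def)
    also have "\<dots> = (\<Sum>v\<in>e. \<Sum>C\<in>?K. x C * indicator C v)"
      using combination eV by (intro sum.cong) auto
    also have "\<dots> = (\<Sum>C\<in>?K. x C * (\<Sum>v\<in>e. indicator C v))"
      by (subst sum.swap) (simp add: sum_distrib_left)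
    also have "\<dots> = (\<Sum>C\<in>?K. x C * card (C \<inter> e))"
      using eV by (simp add: sum_indicator_real Int_commute)
    finally have "(\<Sum>C\<in>?K. x C * (1 - real (card (C \<inter> e)))) = 0"
      using total by (simp add: right_diff_distrib sum_subtractf)
    moreover have "0 \<le> x D * (1 - real (card (D \<inter> e)))" if "D \<in> ?K" for D
      using nonneg[of D] card_clique_Int_edge_le[of D V E e] that e by simp
    ultimately have "x C * (1 - real (card (C \<inter> e))) = 0"
      using C(1) fin by (subst (asm) sum_nonneg_eq_0_iff) blast+
    then show ?thesis using C(2) by simp
  qed
  \<comment> \<open>Cliques of weight 0 are dropped because they may miss an edge, and then their
    indicators are not models.\<close>
  define S where "S = {C \<in> ?K. x C \<noteq> 0}"
  define d where "d C = (\<lambda>v\<in>V. indicator C v :: real)" for C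
  have det: "d C \<in> deterministic_models V E" if C: "C \<in> S" for C
  proof -
    have "sum (d C) e = 1" if e: "e \<in> E" for e
    proof -
      have eV: "e \<subseteq> V" "finite e"
        using scen e finite_subset by (auto simp: contextuality_scenario_def)
      then have "sum (d C) e = (\<Sum>v\<in>e. indicator C v)"
        by (auto simp: d_def intro!: sum.cong)
      then show ?thesis
        using card1[of C e] C e eV by (simp add: S_def sum_indicator_real Int_commute)
    qed
    then show ?thesis
      by (auto simp: deterministic_models_def probabilistic_models_def d_def indicator_def)
  qed
  have S: "S \<subseteq> ?K" by (auto simp: S_def)
  have finS: "finite S" using S fin by (rule finite_subset)
  \<comment> \<open>\<open>classical_models\<close> indexes its convex combinations by an initial
    segment of the naturals, so \<open>S\<close> is enumerated.\<close>
  obtain h where h: "bij_betw h {0..<card S} S"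
    using ex_bij_betw_nat_finite[OF finS] by blast
  then have h: "bij_betw h {..<card S} S" by (simp add: atLeast0LessThan)
  have hS: "h i \<in> S" if "i < card S" for i using bij_betwE[OF h] that by simp
  have "(\<Sum>i<card S. x (h i)) = 1"
  proof -
    have "(\<Sum>i<card S. x (h i)) = sum x S" by (rule sum.reindex_bij_betw[OF h])
    also have "\<dots> = sum x ?K" using fin S by (intro sum.mono_neutral_left) (auto simp: S_def)
    finally show ?thesis using total by simp
  qed
  moreover have "p v = (\<Sum>i<card S. x (h i) * d (h i) v)" if "v \<in> V" for v
  proof -
    have "(\<Sum>i<card S. x (h i) * d (h i) v) = (\<Sum>C\<in>S. x C * d C v)"
      by (rule sum.reindex_bij_betw[OF h])
    also have "\<dots> = (\<Sum>C\<in>?K. x C * d C v)"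
      using fin S by (intro sum.mono_neutral_left) (auto simp: S_def)
    finally show ?thesis using combination[OF that] that by (simp add: d_def)
  qed
  moreover have "0 \<le> x (h i)" if "i < card S" for i using nonneg hS[OF that] S by blast
  ultimately show ?thesis
    unfolding classical_models_def using p det hS
    by (intro CollectI conjI exI[of _ "card S"] exI[of _ "\<lambda>i. x (h i)"]
        exI[of _ "\<lambda>i. d (h i)"]) auto
qed

theorem proposition4p2p1:
  fixes V :: "'a set" and E :: "'a set set" and p :: "'a \<Rightarrow> real"
  assumes "contextuality_scenario V E"
    and "p \<in> probabilistic_models V E"
  shows "p \<in> classical_models V E \<longleftrightarrow>
         fractional_packing_number V (non_orthogonality_edges V E) p = 1"
proof -
  have V: "finite V" using assms(1) by (simp add: contextuality_scenario_def)
  \<comment> \<open>An edge exists because the edges cover the nonempty set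
    \<open>V\<close>.\<close>
  obtain e where e: "e \<in> E" using assms(1) by (auto simp: contextuality_scenario_def)
  obtain q where q: "q \<in> fractional_packings V (non_orthogonality_edges V E)"
    and val: "fractional_packing_number V (non_orthogonality_edges V E) p = (\<Sum>v\<in>V. p v * q v)"
    and max: "\<And>r. r \<in> fractional_packings V (non_orthogonality_edges V E) \<Longrightarrow>
      (\<Sum>v\<in>V. p v * r v) \<le> (\<Sum>v\<in>V. p v * q v)"
    using fractional_packing_number_attained[OF V] by blast
  show ?thesis
  proof
    assume "p \<in> classical_models V E"
    then have "(\<Sum>v\<in>V. p v * q v) \<le> 1"
      using classical_packing_le_1[OF assms(1) _ q] by blast
    moreover have "1 \<le> (\<Sum>v\<in>V. p v * q v)"
      using max[OF indicator_edge_packing[OF assms(1) e]] packing_weight_edge[OF assms e] by simp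
    ultimately show "fractional_packing_number V (non_orthogonality_edges V E) p = 1"
      using val by simp
  next
    assume "fractional_packing_number V (non_orthogonality_edges V E) p = 1"
    then show "p \<in> classical_models V E"
      using val max by (intro classical_if_packing_le_1[OF assms]) simp
  qed
qed

end
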